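(* Let $A,B$ be linear operators in a complex Hilbert space $H$ with $\operatorname{dom}(A)\subseteq\operatorname{dom}(B)$. (i) We have $w(A,B)\subseteq W(A,B)$. Moreover, if in addition $0\notin\overline{W(A)}\cap\overline{W(B)}$ or $W(A,B)\neq\mathbb C$, then $W(A,B)\subseteq\overline{w(A,B)}$. (ii) If $B$ is uniformly positive, then $$w(A,B)=W\big(B^{-\frac12}AB^{-\frac12}\big),\qquad \overline{W(A,B)}=\overline{w(A,B)}=\overline{W\big(B^{-\frac12}AB^{-\frac12}\big)},$$ and all these sets are convex.
   Context: For a linear operator $S$ in $H$, $W(S)=\{\langle Sx,x\rangle:x\in\operatorname{dom}(S),\|x\|=1\}$ is the numerical range. For the pencil $\lambda\mapsto A-\lambda B$ (with $A-\lambda B$ defined on $\operatorname{dom}(A)$): $W(A,B)=\{\lambda\in\mathbb C:0\in\overline{W(A-\lambda B)}\}$ and $w(A,B)=\left\{\frac{\langle Ax,x\rangle}{\langle Bx,x\rangle}:x\in\operatorname{dom}(A),\langle Bx,x\rangle\ne0\right\}$. $B$ is uniformly positive if it is selfadjoint and $B\ge c$ for some constant $c>0$. The operator $B^{-1/2}AB^{-1/2}$ has domain $\operatorname{dom}(AB^{-1/2})=\{y\in H:B^{-1/2}y\in\operatorname{dom}(A)\}$. *)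

theory Defs
  imports "HOL-Analysis.Analysis"
begin

class complex_vector = real_vector +
  fixes scaleC :: "complex \<Rightarrow> 'a \<Rightarrow> 'a" (infixr "*\<^sub>C" 75)
  assumes scaleC_add_right: "a *\<^sub>C (x + y) = a *\<^sub>C x + a *\<^sub>C y"
    and scaleC_add_left: "(a + b) *\<^sub>C x = a *\<^sub>C x + b *\<^sub>C x"
    and scaleC_scaleC: "a *\<^sub>C (b *\<^sub>C x) = (a * b) *\<^sub>C x"
    and scaleR_scaleC: "r *\<^sub>R x = complex_of_real r *\<^sub>C x"

text \<open>The inner product is linear in the first argument.\<close>

class complex_inner = complex_vector + real_normed_vector +
  fixes cinner :: "'a \<Rightarrow> 'a \<Rightarrow> complex"
  assumes cinner_commute: "cinner x y = cnj (cinner y x)"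
    and cinner_add_left: "cinner (x + y) z = cinner x z + cinner y z"
    and cinner_scaleC_left: "cinner (c *\<^sub>C x) y = c * cinner x y"
    and cinner_ge_zero: "0 \<le> Re (cinner x x)"
    and cinner_eq_zero_iff: "cinner x x = 0 \<longleftrightarrow> x = 0"
    and norm_eq_sqrt_cinner: "norm x = sqrt (Re (cinner x x))"

class chilbert_space = complex_inner + complete_space

text \<open>
  A possibly unbounded operator in \<open>H\<close> is a partial map \<open>S :: H \<rightharpoonup> H\<close> with domain
  \<^term>\<open>dom S\<close> and value \<^term>\<open>the (S x)\<close> at \<open>x \<in> dom S\<close>. Equality of partial maps is equality of
  operators, including their domains, and \<^term>\<open>S \<circ>\<^sub>m T\<close> is the product with its natural domain
  \<open>{x \<in> dom T. T x \<in> dom S}\<close>.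
\<close>

definition linear_operator :: "('a::complex_vector \<rightharpoonup> 'a) \<Rightarrow> bool" where
  "linear_operator S \<longleftrightarrow>
     0 \<in> dom S \<and>
     (\<forall>x\<in>dom S. \<forall>y\<in>dom S. x + y \<in> dom S \<and> the (S (x + y)) = the (S x) + the (S y)) \<and>
     (\<forall>c. \<forall>x\<in>dom S. c *\<^sub>C x \<in> dom S \<and> the (S (c *\<^sub>C x)) = c *\<^sub>C the (S x))"

definition numerical_range :: "('a::complex_inner \<rightharpoonup> 'a) \<Rightarrow> complex set" where
  "numerical_range S = {cinner (the (S x)) x | x. x \<in> dom S \<and> norm x = 1}"

definition pencil :: "('a::complex_vector \<rightharpoonup> 'a) \<Rightarrow> ('a \<rightharpoonup> 'a) \<Rightarrow> complex \<Rightarrow> ('a \<rightharpoonup> 'a)" where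
  "pencil A B \<mu> = (\<lambda>x. if x \<in> dom A then Some (the (A x) - \<mu> *\<^sub>C the (B x)) else None)"

definition pencil_range :: "('a::complex_inner \<rightharpoonup> 'a) \<Rightarrow> ('a \<rightharpoonup> 'a) \<Rightarrow> complex set" where
  "pencil_range A B = {\<mu>. 0 \<in> closure (numerical_range (pencil A B \<mu>))}"

definition quotient_range :: "('a::complex_inner \<rightharpoonup> 'a) \<Rightarrow> ('a \<rightharpoonup> 'a) \<Rightarrow> complex set" where
  "quotient_range A B =
     {cinner (the (A x)) x / cinner (the (B x)) x | x. x \<in> dom A \<and> cinner (the (B x)) x \<noteq> 0}"

text \<open>The vector \<open>z\<close> below is unique when \<open>dom S\<close> is dense; only that case is used.\<close>

definition adjoint_operator :: "('a::complex_inner \<rightharpoonup> 'a) \<Rightarrow> ('a \<rightharpoonup> 'a)" where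
  "adjoint_operator S =
     (\<lambda>y. if \<exists>z. \<forall>x\<in>dom S. cinner (the (S x)) y = cinner x z
          then Some (THE z. \<forall>x\<in>dom S. cinner (the (S x)) y = cinner x z)
          else None)"

definition selfadjoint :: "('a::complex_inner \<rightharpoonup> 'a) \<Rightarrow> bool" where
  "selfadjoint S \<longleftrightarrow> linear_operator S \<and> closure (dom S) = UNIV \<and> adjoint_operator S = S"

text \<open>For selfadjoint \<open>S\<close> the numbers \<^term>\<open>cinner (the (S x)) x\<close> are real, so that
  \<open>S \<ge> c\<close> may be stated through their real parts.\<close>

definition bounded_below_by :: "('a::complex_inner \<rightharpoonup> 'a) \<Rightarrow> real \<Rightarrow> bool" where
  "bounded_below_by S c \<longleftrightarrow> (\<forall>x\<in>dom S. c * (norm x)\<^sup>2 \<le> Re (cinner (the (S x)) x))"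

definition uniformly_positive :: "('a::complex_inner \<rightharpoonup> 'a) \<Rightarrow> bool" where
  "uniformly_positive S \<longleftrightarrow> selfadjoint S \<and> (\<exists>c>0. bounded_below_by S c)"

text \<open>The inverse of an injective operator, defined on its range.\<close>

definition inverse_operator :: "('a \<rightharpoonup> 'a) \<Rightarrow> ('a \<rightharpoonup> 'a)" where
  "inverse_operator S = (\<lambda>y. if y \<in> ran S then Some (THE x. S x = Some y) else None)"

text \<open>A nonnegative selfadjoint operator in a Hilbert space has exactly one nonnegative selfadjoint
  square root, so the choice made here is no choice.\<close>

definition sqrt_operator :: "('a::chilbert_space \<rightharpoonup> 'a) \<Rightarrow> ('a \<rightharpoonup> 'a)" where
  "sqrt_operator S = (SOME R. selfadjoint R \<and> bounded_below_by R 0 \<and> R \<circ>\<^sub>m R = S)"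

text \<open>\<open>B\<^sup>-\<^sup>1\<^sup>/\<^sup>2\<close> for uniformly positive \<open>B\<close>.\<close>

definition inverse_sqrt_operator :: "('a::chilbert_space \<rightharpoonup> 'a) \<Rightarrow> ('a \<rightharpoonup> 'a)" where
  "inverse_sqrt_operator B = sqrt_operator (inverse_operator B)"

end

(*
  (i) A unit sequence x_n with <A x_n, x_n> - mu <B x_n, x_n> -> 0 gives quotients converging to mu
  unless <B x_n, x_n> -> 0 along a subsequence. In that case <A x_n, x_n> -> 0 as well, so 0 lies in
  the closures of W(A) and W(B), and 0 lies in the closure of W(A - nu B) for every nu.

  (ii) The inverse of B is bounded and everywhere defined, since ran B is closed and its orthogonal
  complement is ker B = 0. Its square root R is a binomial series in the contraction 1 - c B^-1, which
  converges absolutely. Substituting x = R y turns <Ax,x> / <Bx,x> into <R A R y, y> / <y,y>, and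
  convexity is the Toeplitz-Hausdorff theorem. W(A,B) itself is convex because a half plane separating
  0 from W(A - kappa B) also works for all mu on one side of kappa.
*)

theory Submission imports Defs
begin

\<comment> \<open>For unbounded B the number 0 lies in the spectrum of the inverse, so 1 - c B^-1
  has norm exactly 1 and the square root series is used on the boundary of its disc of convergence.
  Everything then rests on two facts about the coefficients of sqrt (1 - x): all but the first are
  nonpositive, and their partial sums stay nonnegative. Together they give absolute summability as
  well as positivity of the root.

  \<open>inverse_sqrt_operator\<close> is a choice. The series only proves that a root exists; the
  rest is read off the specification of the chosen one.

  In (ii), W(A,B) lies between w(A,B) and its closure, but a set between a convex set and its
  closure need not be convex. This is why W(A,B) has a separation argument of its own.\<close>
subclass (in chilbert_space) banach ..

subsection \<open>Complex inner product spaces\<close>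

lemma cinner_add_right: "cinner x (y + z) = cinner x y + cinner x z"
  for x y z :: "'a::complex_inner"
  by (metis cinner_add_left cinner_commute complex_cnj_add)

lemma cinner_scaleC_right: "cinner x (c *\<^sub>C y) = cnj c * cinner x y"
  for x y :: "'a::complex_inner"
  by (metis cinner_scaleC_left cinner_commute complex_cnj_mult)

lemma cinner_scaleR_left: "cinner (r *\<^sub>R x) y = r *\<^sub>R cinner x y"
  for x y :: "'a::complex_inner"
  by (simp add: scaleR_scaleC cinner_scaleC_left scaleR_conv_of_real)

lemma cinner_scaleR_right: "cinner x (r *\<^sub>R y) = r *\<^sub>R cinner x y"
  for x y :: "'a::complex_inner"
  by (simp add: scaleR_scaleC cinner_scaleC_right scaleR_conv_of_real)

lemma cinner_zero_left [simp]: "cinner 0 y = 0" for y :: "'a::complex_inner"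
  using cinner_scaleR_left[of 0 0 y] by simp

lemma cinner_zero_right [simp]: "cinner x 0 = 0" for x :: "'a::complex_inner"
  using cinner_scaleR_right[of x 0 0] by simp

lemma cinner_diff_left: "cinner (x - y) z = cinner x z - cinner y z"
  for x y z :: "'a::complex_inner"
  using cinner_add_left[of "x - y" y z] by simp

lemma cinner_diff_right: "cinner x (y - z) = cinner x y - cinner x z"
  for x y z :: "'a::complex_inner"
  using cinner_add_right[of x "y - z" z] by simp

lemma power2_norm_cinner: "(norm x)\<^sup>2 = Re (cinner x x)" for x :: "'a::complex_inner"
  by (simp add: norm_eq_sqrt_cinner cinner_ge_zero)

lemma cinner_self: "cinner x x = complex_of_real ((norm x)\<^sup>2)" for x :: "'a::complex_inner"
proof -
  have "Im (cinner x x) = 0"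
    using arg_cong[OF cinner_commute[of x x], of Im] by simp
  then show ?thesis
    by (simp add: power2_norm_cinner complex_eq_iff)
qed

lemma Re_cinner_commute: "Re (cinner x y) = Re (cinner y x)" for x y :: "'a::complex_inner"
  by (subst cinner_commute) simp

lemma norm_scaleC: "norm (c *\<^sub>C x) = cmod c * norm x" for x :: "'a::complex_inner"
proof -
  have "(norm (c *\<^sub>C x))\<^sup>2 = Re ((c * cnj c) * cinner x x)"
    by (simp add: power2_norm_cinner cinner_scaleC_left cinner_scaleC_right algebra_simps)
  also have "\<dots> = (cmod c * norm x)\<^sup>2"
    by (simp only: complex_norm_square[symmetric] cinner_self of_real_mult[symmetric]
        Re_complex_of_real power_mult_distrib)
  finally show ?thesis
    by (simp add: power2_eq_iff_nonneg)
qed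

lemma scaleC_one [simp]: "1 *\<^sub>C x = x" for x :: "'a::complex_vector"
  using scaleR_scaleC[of 1 x] by simp

lemma scaleC_zero_left [simp]: "0 *\<^sub>C x = 0" for x :: "'a::complex_vector"
  using scaleR_scaleC[of 0 x] by simp

lemma scaleC_minus_left: "(- c) *\<^sub>C x = - (c *\<^sub>C x)" for x :: "'a::complex_vector"
  using scaleC_add_left[of c "- c" x] by (simp add: eq_neg_iff_add_eq_0 add.commute)

lemma scaleC_diff_right: "c *\<^sub>C (x - y) = c *\<^sub>C x - c *\<^sub>C y"
  for x y :: "'a::complex_vector"
  using scaleC_add_right[of c "x - y" y] by simp

lemma power2_norm_diff:
  "(norm (x - y))\<^sup>2 = (norm x)\<^sup>2 - 2 * Re (cinner x y) + (norm y)\<^sup>2"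
  for x y :: "'a::complex_inner"
  by (simp add: power2_norm_cinner cinner_diff_left cinner_diff_right Re_cinner_commute[of y x])

lemma parallelogram:
  "(norm (x + y))\<^sup>2 + (norm (x - y))\<^sup>2 = 2 * (norm x)\<^sup>2 + 2 * (norm y)\<^sup>2"
  for x y :: "'a::complex_inner"
  by (simp add: power2_norm_cinner cinner_add_left cinner_add_right cinner_diff_left
      cinner_diff_right)

text \<open>The residual of orthogonal projection onto the line through \<open>y\<close>. That it is
  nonnegative is Cauchy-Schwarz; read as a gain in squared distance, it makes a nearest point
  orthogonal.\<close>

lemma power2_norm_residual:
  fixes x y :: "'a::complex_inner"
  assumes "y \<noteq> 0"
  shows "(norm (x - (cinner x y / (norm y)\<^sup>2) *\<^sub>C y))\<^sup>2
    = (norm x)\<^sup>2 - (cmod (cinner x y))\<^sup>2 / (norm y)\<^sup>2"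
proof -
  have "cinner x y * cnj (cinner x y) = complex_of_real ((cmod (cinner x y))\<^sup>2)"
    by (simp only: complex_norm_square)
  then have "cinner x ((cinner x y / (norm y)\<^sup>2) *\<^sub>C y)
      = complex_of_real ((cmod (cinner x y))\<^sup>2 / (norm y)\<^sup>2)"
    by (simp add: cinner_scaleC_right mult.commute)
  moreover have "(norm ((cinner x y / (norm y)\<^sup>2) *\<^sub>C y))\<^sup>2 = (cmod (cinner x y))\<^sup>2 / (norm y)\<^sup>2"
    using assms by (simp add: norm_scaleC norm_divide norm_power power_mult_distrib power_divide)
      (simp add: power2_eq_square power4_eq_xxxx)
  ultimately show ?thesis
    by (simp only: power2_norm_diff Re_complex_of_real)
qed

lemma cinner_Cauchy_Schwarz: "cmod (cinner x y) \<le> norm x * norm y"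
  for x y :: "'a::complex_inner"
proof (cases "y = 0")
  case False
  have "0 \<le> (norm x)\<^sup>2 - (cmod (cinner x y))\<^sup>2 / (norm y)\<^sup>2"
    using power2_norm_residual[OF False, of x] by (metis zero_le_power2)
  then have "(cmod (cinner x y))\<^sup>2 \<le> (norm x * norm y)\<^sup>2"
    using False by (simp add: field_simps)
  then show ?thesis
    by (simp add: power2_le_iff_abs_le)
qed simp

lemma Re_cinner_le: "Re (cinner x y) \<le> norm x * norm y" for x y :: "'a::complex_inner"
  using complex_Re_le_cmod cinner_Cauchy_Schwarz order_trans by blast

text \<open>Conjugate linearity in the second argument is plain linearity over the reals, so limits
  and series pass through both arguments.\<close>

lemma bounded_bilinear_cinner:
  "bounded_bilinear (cinner :: 'a::complex_inner \<Rightarrow> 'a \<Rightarrow> complex)"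
  by unfold_locales
    (auto simp: cinner_add_left cinner_add_right cinner_scaleR_left cinner_scaleR_right
      intro!: exI[of _ 1] cinner_Cauchy_Schwarz)

lemmas tendsto_cinner = bounded_bilinear.tendsto[OF bounded_bilinear_cinner]
lemmas bounded_linear_cinner_left = bounded_bilinear.bounded_linear_left[OF bounded_bilinear_cinner]
lemmas bounded_linear_cinner_right = bounded_bilinear.bounded_linear_right[OF bounded_bilinear_cinner]

text \<open>Test against a sequence in \<open>D\<close> that converges to \<open>z - w\<close>
  itself. This makes the value of \<open>adjoint_operator\<close> unique.\<close>

lemma cinner_ext_dense:
  fixes z :: "'a::complex_inner"
  assumes "closure D = UNIV" and "\<And>x. x \<in> D \<Longrightarrow> cinner x z = cinner x w"
  shows "z = w"
proof -
  obtain u where u: "\<And>n. u n \<in> D" "u \<longlonglongrightarrow> z - w"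
    using assms(1) closure_sequential[of "z - w" D] by fast
  have lim: "(\<lambda>n. cinner (u n) (z - w)) \<longlonglongrightarrow> cinner (z - w) (z - w)"
    by (intro tendsto_cinner u tendsto_const)
  have "cinner (u n) (z - w) = 0" for n
    using assms(2)[OF u(1)] by (simp add: cinner_diff_right)
  then have "cinner (z - w) (z - w) = 0"
    using lim by (simp add: LIMSEQ_const_iff)
  then show ?thesis
    by (simp add: cinner_eq_zero_iff)
qed

text \<open>A minimizing sequence for the distance from a point \<open>z\<close> outside
  \<open>M\<close> converges in \<open>M\<close>, and \<open>w\<close> is the vector from its limit
  to \<open>z\<close>.\<close>

lemma closed_subspace_orthogonal:
  fixes M :: "'a::chilbert_space set"
  assumes "closed M" and "0 \<in> M" and "M \<noteq> UNIV"
    and add: "\<And>x y. \<lbrakk>x \<in> M; y \<in> M\<rbrakk> \<Longrightarrow> x + y \<in> M"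
    and scale: "\<And>c x. x \<in> M \<Longrightarrow> c *\<^sub>C x \<in> M"
  obtains w where "w \<noteq> 0" "\<And>m. m \<in> M \<Longrightarrow> cinner w m = 0"
proof -
  obtain z where z: "z \<notin> M"
    using assms(3) by auto
  define D where "D = (INF m\<in>M. (norm (z - m))\<^sup>2)"
  have bdd: "bdd_below ((\<lambda>m. (norm (z - m))\<^sup>2) ` M)"
    by (intro bdd_belowI[of _ 0]) auto
  have D: "D \<le> (norm (z - m))\<^sup>2" if "m \<in> M" for m
    unfolding D_def using bdd that by (rule cINF_lower)
  have "\<exists>m\<in>M. (norm (z - m))\<^sup>2 < D + 1 / Suc n" for n
    using cINF_less_iff[OF _ bdd, of "D + 1 / Suc n"] \<open>0 \<in> M\<close> by (auto simp: D_def)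
  then obtain u where uM: "\<And>n. u n \<in> M" and u: "\<And>n. (norm (z - u n))\<^sup>2 < D + 1 / Suc n"
    by metis
  \<comment> \<open>The midpoint of \<open>u k\<close> and \<open>u l\<close> lies in
    \<open>M\<close>, so its squared distance from \<open>z\<close> is at least \<open>D\<close>;
    the parallelogram law then leaves little room between the two.\<close>
  have near: "(norm (u k - u l))\<^sup>2 \<le> 2 * (1 / Suc k) + 2 * (1 / Suc l)" for k l
  proof -
    have "(1/2) *\<^sub>R (u k + u l) \<in> M"
      unfolding scaleR_scaleC by (intro scale add uM)
    then have "4 * D \<le> 4 * (norm (z - (1/2) *\<^sub>R (u k + u l)))\<^sup>2"
      using D by simp
    also have "\<dots> = (norm (2 *\<^sub>R (z - (1/2) *\<^sub>R (u k + u l))))\<^sup>2"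
      by (simp add: power_mult_distrib)
    also have "2 *\<^sub>R (z - (1/2) *\<^sub>R (u k + u l)) = (z - u k) + (z - u l)"
      by (simp add: algebra_simps scaleR_2)
    finally have "4 * D \<le> (norm ((z - u k) + (z - u l)))\<^sup>2" .
    moreover have "(norm ((z - u k) - (z - u l)))\<^sup>2 = (norm (u k - u l))\<^sup>2"
      by (simp add: norm_minus_commute)
    ultimately show ?thesis
      using parallelogram[of "z - u k" "z - u l"] u[of k] u[of l]
      by linarith
  qed
  have "Cauchy u"
  proof (rule metric_CauchyI)
    fix e :: real assume "0 < e"
    then obtain N where N: "4 / e\<^sup>2 < real N"
      using reals_Archimedean2 by blast
    have "dist (u k) (u l) < e" if "N \<le> k" "N \<le> l" for k l
    proof -
      have "1 / Suc k \<le> 1 / Suc N" "1 / Suc l \<le> 1 / Suc N"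
        using that by (auto intro!: divide_left_mono)
      then have "(norm (u k - u l))\<^sup>2 \<le> 4 * (1 / Suc N)"
        using near[of k l] by linarith
      also have "4 * (1 / Suc N) < e\<^sup>2"
      proof -
        have "4 < real N * e\<^sup>2"
          using N \<open>0 < e\<close> by (simp add: pos_divide_less_eq)
        also have "\<dots> \<le> real (Suc N) * e\<^sup>2"
          by (intro mult_right_mono) auto
        finally show ?thesis
          by (simp add: pos_divide_less_eq mult.commute)
      qed
      finally show ?thesis
        using \<open>0 < e\<close> by (simp add: dist_norm power2_less_imp_less)
    qed
    then show "\<exists>N. \<forall>k\<ge>N. \<forall>l\<ge>N. dist (u k) (u l) < e"
      by blast
  qed
  then obtain m where m: "u \<longlonglongrightarrow> m"
    using Cauchy_convergent convergent_def by blast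
  have mM: "m \<in> M"
    using \<open>closed M\<close> uM m closed_sequentially by blast
  define w where "w = z - m"
  have lim_D: "(\<lambda>n. D + 1 / Suc n) \<longlonglongrightarrow> D"
    using tendsto_add[OF tendsto_const[of D] LIMSEQ_inverse_real_of_nat]
    by (simp add: inverse_eq_divide)
  have lim_w: "(\<lambda>n. (norm (z - u n))\<^sup>2) \<longlonglongrightarrow> (norm w)\<^sup>2"
    unfolding w_def by (intro tendsto_intros m)
  have w: "(norm w)\<^sup>2 \<le> D"
    by (rule LIMSEQ_le[OF lim_w lim_D]) (use u less_imp_le in blast)
  have "cinner w v = 0" if "v \<in> M" for v
  proof (cases "v = 0")
    case False
    \<comment> \<open>Moving \<open>m\<close> by the projection of \<open>w\<close> onto
      \<open>v\<close> would lower the squared distance by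
      \<open>(cmod (cinner w v) / norm v)^2\<close>, so minimality forces this to be 0.\<close>
    have "m + (cinner w v / (norm v)\<^sup>2) *\<^sub>C v \<in> M"
      by (intro add scale mM that)
    from D[OF this] have "D \<le> (norm (w - (cinner w v / (norm v)\<^sup>2) *\<^sub>C v))\<^sup>2"
      by (simp add: w_def diff_diff_add)
    then have "(cmod (cinner w v))\<^sup>2 / (norm v)\<^sup>2 \<le> 0"
      using w power2_norm_residual[OF False, of w] by simp
    then show ?thesis
      using False by (simp add: divide_le_0_iff)
  qed simp
  moreover have "w \<noteq> 0"
    using z mM by (auto simp: w_def)
  ultimately show thesis
    using that by blast
qed

subsection \<open>Numerical ranges\<close>

lemma linear_operator_zero: "linear_operator S \<Longrightarrow> 0 \<in> dom S"
  by (simp add: linear_operator_def)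

lemma linear_operator_add:
  assumes "linear_operator S" "x \<in> dom S" "y \<in> dom S"
  shows "x + y \<in> dom S" "the (S (x + y)) = the (S x) + the (S y)"
  using assms by (auto simp: linear_operator_def)

lemma linear_operator_scaleC:
  assumes "linear_operator S" "x \<in> dom S"
  shows "c *\<^sub>C x \<in> dom S" "the (S (c *\<^sub>C x)) = c *\<^sub>C the (S x)"
  using assms by (auto simp: linear_operator_def)

lemma quadratic_form_scaleC:
  fixes S :: "'a::complex_inner \<rightharpoonup> 'a"
  assumes "linear_operator S" "x \<in> dom S"
  shows "cinner (the (S (c *\<^sub>C x))) (c *\<^sub>C x) = complex_of_real ((cmod c)\<^sup>2) * cinner (the (S x)) x"
proof -
  have "cinner (the (S (c *\<^sub>C x))) (c *\<^sub>C x) = (c * cnj c) * cinner (the (S x)) x"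
    using assms by (simp add: linear_operator_scaleC cinner_scaleC_left cinner_scaleC_right)
  then show ?thesis
    by (simp only: complex_norm_square)
qed

text \<open>Division by zero gives 0, so at \<open>x = 0\<close> both sides vanish.\<close>

lemma quadratic_form_normalized:
  fixes S :: "'a::complex_inner \<rightharpoonup> 'a"
  assumes "linear_operator S" "x \<in> dom S"
  shows "cinner (the (S (complex_of_real (1 / norm x) *\<^sub>C x))) (complex_of_real (1 / norm x) *\<^sub>C x)
    = cinner (the (S x)) x / complex_of_real ((norm x)\<^sup>2)"
  using quadratic_form_scaleC[OF assms, of "complex_of_real (1 / norm x)"]
  by (simp add: norm_divide power_divide)

lemma norm_normalized:
  fixes x :: "'a::complex_inner"
  assumes "x \<noteq> 0"
  shows "norm (complex_of_real (1 / norm x) *\<^sub>C x) = 1"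
  using assms by (simp add: norm_scaleC norm_divide)

text \<open>The Toeplitz--Hausdorff theorem. After the phase of \<open>x\<close> is adjusted, the quotient
  \<open>\<langle>Sz,z\<rangle> / \<parallel>z\<parallel>\<^sup>2\<close> stays on the line through \<open>\<langle>Sx,x\<rangle>\<close> and \<open>\<langle>Sy,y\<rangle>\<close> as \<open>z\<close> moves along the
  segment from \<open>x\<close> to \<open>y\<close>.\<close>

lemma convex_numerical_range:
  fixes S :: "'a::complex_inner \<rightharpoonup> 'a"
  assumes S: "linear_operator S"
  shows "convex (numerical_range S)"
  unfolding convex_alt
proof (intro ballI allI impI)
  fix p r :: complex and t :: real
  assume "p \<in> numerical_range S" and "r \<in> numerical_range S" and t: "0 \<le> t \<and> t \<le> 1"
  then obtain x y where x: "x \<in> dom S" "norm x = 1" "p = cinner (the (S x)) x"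
    and y: "y \<in> dom S" "norm y = 1" "r = cinner (the (S y)) y"
    unfolding numerical_range_def by blast
  show "(1 - t) *\<^sub>R p + t *\<^sub>R r \<in> numerical_range S"
  proof (cases "p = r")
    case True
    then show ?thesis
      using \<open>p \<in> numerical_range S\<close> by (simp add: algebra_simps)
  next
    case False
    define d where "d = r - p"
    have d: "d \<noteq> 0"
      using False by (simp add: d_def)
    \<comment> \<open>The affine map taking \<open>q\<close> to \<open>(q - p) / d\<close> sends
      \<open>p\<close> to 0 and \<open>r\<close> to 1; \<open>v\<close> and \<open>w\<close> are the
      cross terms of the form after this map.\<close>
    define v where "v = (cinner (the (S x)) y - p * cinner x y) / d"
    define w where "w = (cinner (the (S y)) x - p * cinner y x) / d"
    obtain \<omega> where \<omega>: "cmod \<omega> = 1" "Im (\<omega> * v + cnj \<omega> * w) = 0"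
    proof (cases "v = cnj w")
      case True
      show ?thesis
        by (rule that[of 1]) (auto simp: True)
    next
      case False
      \<comment> \<open>\<open>Im (\<omega> * v + cnj \<omega> * w)\<close> equals
        \<open>Im (\<omega> * (v - cnj w))\<close>, which vanishes for the conjugate phase of
        \<open>v - cnj w\<close>.\<close>
      define \<omega> where "\<omega> = cnj (v - cnj w) / cmod (v - cnj w)"
      have "\<omega> * (v - cnj w) = complex_of_real ((cmod (v - cnj w))\<^sup>2) / cmod (v - cnj w)"
        unfolding \<omega>_def complex_norm_square times_divide_eq_left by (simp only: mult.commute)
      then have "Im (\<omega> * (v - cnj w)) = 0"
        by (metis Im_complex_of_real of_real_divide)
      moreover have "cmod \<omega> = 1"
        using False by (simp add: \<omega>_def norm_divide del: complex_cnj_diff)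
      ultimately show ?thesis
        by (intro that[of \<omega>]) (auto simp: algebra_simps)
    qed
    define k where "k = Re (\<omega> * v + cnj \<omega> * w)"
    have k: "\<omega> * v + cnj \<omega> * w = complex_of_real k"
      using \<omega>(2) by (simp add: k_def complex_eq_iff)
    define z where "z s = complex_of_real (1 - s) *\<^sub>C (\<omega> *\<^sub>C x) + complex_of_real s *\<^sub>C y" for s
    have zS: "z s \<in> dom S" for s
      unfolding z_def by (intro linear_operator_add linear_operator_scaleC S x y)
    have \<omega>\<omega>: "\<omega> * cnj \<omega> = 1"
      using \<omega>(1) by (simp add: complex_norm_square[symmetric])
    have "cinner (the (S (z s))) (z s) - p * cinner (z s) (z s)
        = complex_of_real (1 - s) * complex_of_real (1 - s) * (\<omega> * cnj \<omega>) * (cinner (the (S x)) x - p * cinner x x)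
        + complex_of_real s * complex_of_real (1 - s) * (\<omega> * (cinner (the (S x)) y - p * cinner x y)
            + cnj \<omega> * (cinner (the (S y)) x - p * cinner y x))
        + complex_of_real s * complex_of_real s * (cinner (the (S y)) y - p * cinner y y)" for s
      unfolding z_def using S x(1) y(1)
      by (simp add: linear_operator_add linear_operator_scaleC cinner_add_left cinner_add_right
          cinner_scaleC_left cinner_scaleC_right) (simp add: algebra_simps)
    also have "\<dots> s = complex_of_real s * complex_of_real (1 - s) * (\<omega> * (v * d) + cnj \<omega> * (w * d))
        + complex_of_real s * complex_of_real s * d" for s
      using x y d unfolding v_def w_def by (simp add: cinner_self \<omega>\<omega> d_def)
    also have "\<dots> s = complex_of_real (s * (1 - s) * k + s * s) * d" for s
      unfolding of_real_add of_real_mult k[symmetric] by (simp add: algebra_simps)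
    finally have q: "cinner (the (S (z s))) (z s)
        = p * complex_of_real ((norm (z s))\<^sup>2) + complex_of_real (s * (1 - s) * k + s * s) * d" for s
      by (simp only: cinner_self diff_eq_eq add.commute)
    \<comment> \<open>A zero of \<open>z\<close> forces \<open>s = 1/2\<close> and makes
      \<open>y\<close> a unimodular multiple of \<open>x\<close>. The form then has the same value
      at both, against \<open>p \<noteq> r\<close>.\<close>
    have z_nz: "z s \<noteq> 0" if "0 \<le> s" "s \<le> 1" for s
    proof
      assume "z s = 0"
      then have eq: "complex_of_real (1 - s) *\<^sub>C (\<omega> *\<^sub>C x) = - (complex_of_real s *\<^sub>C y)"
        by (simp add: z_def eq_neg_iff_add_eq_0)
      from arg_cong[OF eq, of norm] have half: "1 - s = 1/2" "s = 1/2"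
        using that x y \<omega>(1) by (simp_all only: norm_minus_cancel norm_scaleC norm_of_real) simp_all
      then have "(1/2) *\<^sub>R (\<omega> *\<^sub>C x) = (1/2) *\<^sub>R (- y)"
        using eq[unfolded half(1), unfolded half(2), folded scaleR_scaleC] by simp
      then have "\<omega> *\<^sub>C x = - y"
        by (simp del: scaleR_minus_right)
      then have "y = (- \<omega>) *\<^sub>C x"
        by (simp add: scaleC_minus_left)
      then have "r = p"
        using quadratic_form_scaleC[OF S x(1), of "- \<omega>"] x y \<omega>(1) by simp
      with False show False by simp
    qed
    \<comment> \<open>The quotient is the coordinate of the point on the line from \<open>p\<close>
      to \<open>r\<close>. It is 0 at \<open>s = 0\<close> and 1 at \<open>s = 1\<close>, so it
      takes the value \<open>t\<close> in between.\<close>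
    have "continuous_on {0..1} (\<lambda>s. (s * (1 - s) * k + s * s) / (norm (z s))\<^sup>2)"
      unfolding z_def scaleR_scaleC[symmetric]
      by (intro continuous_intros ballI)
        (use z_nz in \<open>auto simp: z_def scaleR_scaleC\<close>)
    then obtain s where s: "0 \<le> s" "s \<le> 1" "(s * (1 - s) * k + s * s) / (norm (z s))\<^sup>2 = t"
      using IVT'[of "\<lambda>s. (s * (1 - s) * k + s * s) / (norm (z s))\<^sup>2" 0 t 1] t y
      by (auto simp: z_def)
    define u where "u = complex_of_real (1 / norm (z s)) *\<^sub>C z s"
    have nz: "norm (z s) \<noteq> 0"
      using z_nz s by simp
    have "cinner (the (S u)) u = cinner (the (S (z s))) (z s) / complex_of_real ((norm (z s))\<^sup>2)"
      unfolding u_def by (rule quadratic_form_normalized[OF S zS])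
    also have "\<dots> = p + complex_of_real ((s * (1 - s) * k + s * s) / (norm (z s))\<^sup>2) * d"
      unfolding q of_real_divide using nz by (simp add: add_divide_distrib distrib_right)
    also have "\<dots> = (1 - t) *\<^sub>R p + t *\<^sub>R r"
      unfolding s(3) by (simp add: d_def scaleR_conv_of_real algebra_simps)
    finally have "cinner (the (S u)) u = (1 - t) *\<^sub>R p + t *\<^sub>R r" .
    moreover have "u \<in> dom S"
      unfolding u_def by (rule linear_operator_scaleC[OF S zS])
    moreover have "norm u = 1"
      unfolding u_def using z_nz[OF s(1,2)] by (rule norm_normalized)
    ultimately show ?thesis
      unfolding numerical_range_def by (smt (verit) mem_Collect_eq)
  qed
qed

section \<open>The range of the pencil and the range of quotients\<close>

lemma zero_in_closure_numerical_range_iff: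
  "0 \<in> closure (numerical_range S) \<longleftrightarrow>
    (\<forall>e>0. \<exists>x\<in>dom S. norm x = 1 \<and> cmod (cinner (the (S x)) x) < e)"
  unfolding closure_approachable numerical_range_def by (auto simp: Bex_def) blast+

lemma dom_pencil [simp]: "dom (pencil A B \<mu>) = dom A"
  by (auto simp: pencil_def split: if_splits)

lemma pencil_quadratic_form:
  "x \<in> dom A \<Longrightarrow> cinner (the (pencil A B \<mu> x)) x = cinner (the (A x)) x - \<mu> * cinner (the (B x)) x"
  by (simp add: pencil_def cinner_diff_left cinner_scaleC_left)

lemma mem_pencil_range_iff:
  "\<mu> \<in> pencil_range A B \<longleftrightarrow>
    (\<forall>e>0. \<exists>x\<in>dom A. norm x = 1 \<and> cmod (cinner (the (A x)) x - \<mu> * cinner (the (B x)) x) < e)"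
  unfolding pencil_range_def mem_Collect_eq zero_in_closure_numerical_range_iff dom_pencil
  by (simp add: pencil_quadratic_form cong: bex_cong)

text \<open>Normalization multiplies both forms by the same factor, which cancels; \<open>x\<close>
  is nonzero because the form of \<open>B\<close> is.\<close>

lemma quotient_range_normalized:
  fixes A B :: "'a::complex_inner \<rightharpoonup> 'a"
  assumes A: "linear_operator A" and B: "linear_operator B" and "dom A \<subseteq> dom B"
    and "\<mu> \<in> quotient_range A B"
  obtains x where "x \<in> dom A" "norm x = 1" "cinner (the (B x)) x \<noteq> 0"
    "\<mu> = cinner (the (A x)) x / cinner (the (B x)) x"
proof -
  obtain x where x: "x \<in> dom A" "cinner (the (B x)) x \<noteq> 0"
    "\<mu> = cinner (the (A x)) x / cinner (the (B x)) x"
    using assms(4) unfolding quotient_range_def by blast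
  then have "x \<noteq> 0" "x \<in> dom B"
    using assms(3) by auto
  then show thesis
    using x linear_operator_scaleC(1)[OF A x(1)] norm_normalized[OF \<open>x \<noteq> 0\<close>]
      quadratic_form_normalized[OF A x(1)] quadratic_form_normalized[OF B \<open>x \<in> dom B\<close>]
    by (intro that[of "complex_of_real (1 / norm x) *\<^sub>C x"]) simp_all
qed

lemma quotient_range_subset_pencil_range:
  fixes A B :: "'a::complex_inner \<rightharpoonup> 'a"
  assumes "linear_operator A" "linear_operator B" "dom A \<subseteq> dom B"
  shows "quotient_range A B \<subseteq> pencil_range A B"
proof
  fix \<mu> assume "\<mu> \<in> quotient_range A B"
  from quotient_range_normalized[OF assms this] obtain x where "x \<in> dom A" "norm x = 1"
    "cinner (the (A x)) x - \<mu> * cinner (the (B x)) x = 0"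
    by (metis eq_iff_diff_eq_0 nonzero_eq_divide_eq)
  then show "\<mu> \<in> pencil_range A B"
    unfolding mem_pencil_range_iff by (metis norm_zero)
qed

text \<open>The common core of both alternatives in (i): each supplies an \<open>e\<close> that
  keeps the two forms from being small at the same unit vector.\<close>

lemma pencil_range_subset_closure_quotient_range:
  fixes A B :: "'a::complex_inner \<rightharpoonup> 'a"
  assumes "0 < e" and e: "\<And>x. \<lbrakk>x \<in> dom A; norm x = 1\<rbrakk> \<Longrightarrow>
      e \<le> cmod (cinner (the (A x)) x) \<or> e \<le> cmod (cinner (the (B x)) x)"
  shows "pencil_range A B \<subseteq> closure (quotient_range A B)"
proof
  fix \<mu> assume \<mu>: "\<mu> \<in> pencil_range A B"
  \<comment> \<open>For the forms \<open>a\<close>, \<open>b\<close> at a unit vector,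
    \<open>cmod b < m\<close> and \<open>cmod (a - \<mu> * b) < e / 2\<close> would make both
    \<open>cmod a\<close> and \<open>cmod b\<close> smaller than \<open>e\<close>.\<close>
  define m where "m = (e / 2) / (1 + cmod \<mu>)"
  have pos: "0 < 1 + cmod \<mu>"
    by (simp add: add_pos_nonneg)
  have "(1 + cmod \<mu>) * m = e / 2"
    unfolding m_def times_divide_eq_right[of _ "e / 2"] using pos
    by (intro nonzero_mult_div_cancel_left) simp
  moreover have "0 < m"
    unfolding m_def using \<open>0 < e\<close> pos by simp
  ultimately have m: "0 < m" "m + cmod \<mu> * m = e / 2"
    by (simp_all add: distrib_right)
  show "\<mu> \<in> closure (quotient_range A B)"
    unfolding closure_approachable
  proof (intro allI impI)
    fix \<delta> :: real assume "0 < \<delta>"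
    \<comment> \<open>The bound \<open>e / 2\<close> secures \<open>m \<le> cmod b\<close>; after
      division by \<open>b\<close>, the bound \<open>\<delta> * m\<close> becomes a distance below
      \<delta>.\<close>
    then have "0 < min (e / 2) (\<delta> * m)"
      using \<open>0 < e\<close> m by simp
    then obtain x where x: "x \<in> dom A" "norm x = 1"
      and xe: "cmod (cinner (the (A x)) x - \<mu> * cinner (the (B x)) x) < min (e / 2) (\<delta> * m)"
      using \<mu> unfolding mem_pencil_range_iff by blast
    define a b where "a = cinner (the (A x)) x" and "b = cinner (the (B x)) x"
    have ab: "cmod (a - \<mu> * b) < e / 2" "cmod (a - \<mu> * b) < \<delta> * m"
      using xe by (auto simp: a_def b_def)
    have b: "m \<le> cmod b"
    proof (rule ccontr)
      assume "\<not> m \<le> cmod b"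
      then have bm: "cmod b < m" "cmod \<mu> * cmod b \<le> cmod \<mu> * m"
        by (auto intro: mult_left_mono)
      have "cmod a \<le> cmod (a - \<mu> * b) + cmod \<mu> * cmod b"
        using norm_triangle_ineq[of "a - \<mu> * b" "\<mu> * b"] by (simp add: norm_mult)
      moreover have "0 \<le> cmod \<mu> * m"
        using m by simp
      ultimately have "cmod a < e" "cmod b < e"
        using ab bm m \<open>0 < e\<close> by linarith+
      then show False
        using e[OF x] by (simp add: a_def b_def)
    qed
    then have "b \<noteq> 0"
      using m by auto
    have "cmod (a / b - \<mu>) * cmod b = cmod (a - \<mu> * b)"
      using \<open>b \<noteq> 0\<close> by (simp add: norm_mult[symmetric] left_diff_distrib)
    also have "\<dots> < \<delta> * cmod b"
      using ab(2) b \<open>0 < \<delta>\<close> by (smt (verit) mult_left_mono)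
    finally have "dist (a / b) \<mu> < \<delta>"
      by (simp add: dist_norm mult_less_cancel_right)
    moreover have "a / b \<in> quotient_range A B"
      unfolding quotient_range_def using x \<open>b \<noteq> 0\<close> by (auto simp: a_def b_def)
    ultimately show "\<exists>q\<in>quotient_range A B. dist q \<mu> < \<delta>"
      by blast
  qed
qed

lemma pencil_range_subset_closure_if_zero_notin:
  fixes A B :: "'a::complex_inner \<rightharpoonup> 'a"
  assumes "dom A \<subseteq> dom B"
    and "0 \<notin> closure (numerical_range A) \<inter> closure (numerical_range B)"
  shows "pencil_range A B \<subseteq> closure (quotient_range A B)"
proof -
  have "\<exists>e>0. \<forall>x\<in>dom A. norm x = 1 \<longrightarrow>
      e \<le> cmod (cinner (the (A x)) x) \<or> e \<le> cmod (cinner (the (B x)) x)"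
    using assms unfolding Int_iff zero_in_closure_numerical_range_iff
    by (meson not_le subsetD)
  then show ?thesis
    using pencil_range_subset_closure_quotient_range by blast
qed

lemma pencil_range_subset_closure_if_not_UNIV:
  fixes A B :: "'a::complex_inner \<rightharpoonup> 'a"
  assumes "pencil_range A B \<noteq> UNIV"
  shows "pencil_range A B \<subseteq> closure (quotient_range A B)"
proof -
  obtain \<nu> where "\<nu> \<notin> pencil_range A B"
    using assms by auto
  then obtain e where "0 < e" and e: "\<And>x. \<lbrakk>x \<in> dom A; norm x = 1\<rbrakk> \<Longrightarrow>
      e \<le> cmod (cinner (the (A x)) x - \<nu> * cinner (the (B x)) x)"
    unfolding mem_pencil_range_iff by (meson not_le)
  \<comment> \<open>If both forms were below \<open>m\<close> in modulus, the form of
    \<open>pencil A B \<nu>\<close> would be below \<open>(1 + cmod \<nu>) * m = e\<close>.\<close>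
  define m where "m = e / (1 + cmod \<nu>)"
  have pos: "0 < 1 + cmod \<nu>"
    by (simp add: add_pos_nonneg)
  have "(1 + cmod \<nu>) * m = e"
    unfolding m_def times_divide_eq_right using pos by (intro nonzero_mult_div_cancel_left) simp
  moreover have "0 < m"
    unfolding m_def using \<open>0 < e\<close> pos by simp
  ultimately have m: "0 < m" "m + cmod \<nu> * m = e"
    by (simp_all add: distrib_right)
  have "m \<le> cmod (cinner (the (A x)) x) \<or> m \<le> cmod (cinner (the (B x)) x)"
    if x: "x \<in> dom A" "norm x = 1" for x
  proof (rule ccontr)
    define a b where "a = cinner (the (A x)) x" and "b = cinner (the (B x)) x"
    assume "\<not> (m \<le> cmod (cinner (the (A x)) x) \<or> m \<le> cmod (cinner (the (B x)) x))"
    then have "cmod a < m" "cmod \<nu> * cmod b \<le> cmod \<nu> * m"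
      by (auto simp: a_def b_def intro: mult_left_mono)
    moreover have "e \<le> cmod a + cmod \<nu> * cmod b"
      using e[OF x] norm_triangle_ineq4[of a "\<nu> * b"] by (simp add: norm_mult a_def b_def)
    ultimately show False
      using m by linarith
  qed
  then show ?thesis
    using pencil_range_subset_closure_quotient_range[OF m(1)] by blast
qed

lemma linear_operator_pencil:
  fixes A B :: "'a::complex_inner \<rightharpoonup> 'a"
  assumes "linear_operator A" "linear_operator B" "dom A \<subseteq> dom B"
  shows "linear_operator (pencil A B \<mu>)"
  unfolding linear_operator_def dom_pencil
proof (intro conjI ballI allI)
  show "0 \<in> dom A"
    using assms(1) by (rule linear_operator_zero)
next
  fix x y assume x: "x \<in> dom A" and y: "y \<in> dom A"
  show xy: "x + y \<in> dom A"
    by (rule linear_operator_add[OF assms(1) x y])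
  have "x \<in> dom B" "y \<in> dom B"
    using x y assms(3) by auto
  then show "the (pencil A B \<mu> (x + y)) = the (pencil A B \<mu> x) + the (pencil A B \<mu> y)"
    using x y xy assms by (simp add: pencil_def linear_operator_add scaleC_add_right)
next
  fix c x assume x: "x \<in> dom A"
  show cx: "c *\<^sub>C x \<in> dom A"
    by (rule linear_operator_scaleC[OF assms(1) x])
  have "x \<in> dom B"
    using x assms(3) by auto
  then show "the (pencil A B \<mu> (c *\<^sub>C x)) = c *\<^sub>C the (pencil A B \<mu> x)"
    using x cx assms
    by (simp add: pencil_def linear_operator_scaleC scaleC_diff_right scaleC_scaleC mult.commute)
qed

text \<open>A functional \<open>\<langle>n, \<cdot>\<rangle>\<close> separating \<open>0\<close> from \<open>W(A - \<kappa>B)\<close> also separates \<open>0\<close> from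
  \<open>W(A - \<sigma>B)\<close> whenever \<open>\<langle>n,\<sigma>\<rangle> \<le> \<langle>n,\<kappa>\<rangle>\<close>, because \<open>B \<ge> 0\<close>. So each point \<open>\<kappa>\<close> outside the range lies
  on the boundary of a half plane outside the range.\<close>

lemma convex_pencil_range:
  fixes A B :: "'a::complex_inner \<rightharpoonup> 'a"
  assumes A: "linear_operator A" and B: "linear_operator B" and sub: "dom A \<subseteq> dom B"
    and real: "\<And>x. x \<in> dom A \<Longrightarrow> cinner (the (B x)) x \<in> \<real>"
    and nonneg: "\<And>x. x \<in> dom A \<Longrightarrow> 0 \<le> Re (cinner (the (B x)) x)"
  shows "convex (pencil_range A B)"
  unfolding convex_alt
proof (intro ballI allI impI)
  fix \<mu> \<nu> :: complex and t :: real
  assume \<mu>: "\<mu> \<in> pencil_range A B" and \<nu>: "\<nu> \<in> pencil_range A B" and t: "0 \<le> t \<and> t \<le> 1"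
  define \<kappa> where "\<kappa> = (1 - t) *\<^sub>R \<mu> + t *\<^sub>R \<nu>"
  show "(1 - t) *\<^sub>R \<mu> + t *\<^sub>R \<nu> \<in> pencil_range A B"
  proof (rule ccontr)
    assume "(1 - t) *\<^sub>R \<mu> + t *\<^sub>R \<nu> \<notin> pencil_range A B"
    then have "0 \<notin> closure (numerical_range (pencil A B \<kappa>))"
      by (simp add: pencil_range_def \<kappa>_def)
    moreover have "convex (closure (numerical_range (pencil A B \<kappa>)))"
      by (intro convex_closure convex_numerical_range linear_operator_pencil A B sub)
    ultimately obtain n \<beta> where "0 < \<beta>"
      and sep: "\<And>q. q \<in> closure (numerical_range (pencil A B \<kappa>)) \<Longrightarrow> \<beta> < n \<bullet> q"
      using separating_hyperplane_closed_0 closed_closure by metis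
    have half_plane: "\<sigma> \<notin> pencil_range A B" if \<sigma>: "n \<bullet> \<sigma> \<le> n \<bullet> \<kappa>" for \<sigma>
    proof
      assume "\<sigma> \<in> pencil_range A B"
      \<comment> \<open>By Cauchy-Schwarz an error of this size changes \<open>n \<bullet> q\<close>
        by at most \<beta>; the \<open>+ 1\<close> keeps the denominator positive.\<close>
      moreover have "0 < \<beta> / (norm n + 1)"
        using \<open>0 < \<beta>\<close> by (simp add: add_nonneg_pos)
      ultimately obtain x where x: "x \<in> dom A" "norm x = 1"
        and small: "cmod (cinner (the (A x)) x - \<sigma> * cinner (the (B x)) x) < \<beta> / (norm n + 1)"
        unfolding mem_pencil_range_iff by blast
      define a where "a = cinner (the (A x)) x"
      obtain b where b: "cinner (the (B x)) x = complex_of_real b" "0 \<le> b"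
        using real[OF x(1)] nonneg[OF x(1)] by (metis Reals_cases Re_complex_of_real)
      have "cinner (the (pencil A B \<kappa> x)) x \<in> closure (numerical_range (pencil A B \<kappa>))"
        using x by (intro subsetD[OF closure_subset]) (auto simp: numerical_range_def)
      then have "\<beta> < n \<bullet> (a - b *\<^sub>R \<kappa>)"
        using sep x(1) b by (simp add: pencil_quadratic_form a_def scaleR_conv_of_real mult.commute)
      also have "\<dots> \<le> n \<bullet> (a - b *\<^sub>R \<sigma>)"
        using \<sigma> b(2) by (simp add: inner_diff_right mult_left_mono)
      also have "\<dots> \<le> norm n * cmod (a - b *\<^sub>R \<sigma>)"
        by (rule norm_cauchy_schwarz)
      also have "\<dots> \<le> norm n * (\<beta> / (norm n + 1))"
        using small b by (intro mult_left_mono) (auto simp: a_def scaleR_conv_of_real mult.commute)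
      also have "\<dots> \<le> \<beta>"
      proof -
        have "norm n * \<beta> \<le> \<beta> * (norm n + 1)"
          using \<open>0 < \<beta>\<close> by (simp add: algebra_simps)
        then show ?thesis
          unfolding times_divide_eq_right by (subst pos_divide_le_eq) (auto simp: add_nonneg_pos)
      qed
      finally show False by simp
    qed
    have \<kappa>: "n \<bullet> \<kappa> = (1 - t) * (n \<bullet> \<mu>) + t * (n \<bullet> \<nu>)"
      by (simp add: \<kappa>_def inner_add_right)
    \<comment> \<open>Both end points lie strictly on the far side of the line through \<kappa>,
      hence so do their convex combinations; but \<kappa> is one of these.\<close>
    have "n \<bullet> \<kappa> < n \<bullet> \<mu>" "n \<bullet> \<kappa> < n \<bullet> \<nu>"
      using half_plane \<mu> \<nu> by (meson not_le)+
    then have "(1 - t) * (n \<bullet> \<kappa>) + t * (n \<bullet> \<kappa>) < (1 - t) * (n \<bullet> \<mu>) + t * (n \<bullet> \<nu>)"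
      using t by (cases "t = 0")
        (auto intro!: add_le_less_mono mult_left_mono mult_strict_left_mono)
    then show False
      using \<kappa> by (simp add: algebra_simps)
  qed
qed

subsection \<open>The binomial square root of a contraction\<close>

text \<open>The Taylor coefficients of \<open>sqrt (1 - x)\<close>; the Pochhammer form displays
  their signs.\<close>

definition sqrt_coeff :: "nat \<Rightarrow> real" where
  "sqrt_coeff n = pochhammer (- 1/2) n / fact n"

lemma sqrt_coeff_gbinomial: "sqrt_coeff n = ((1/2) gchoose n) * (- 1) ^ n"
  by (simp add: sqrt_coeff_def gbinomial_pochhammer)

lemma sqrt_coeff_0 [simp]: "sqrt_coeff 0 = 1"
  by (simp add: sqrt_coeff_def)

lemma sqrt_coeff_nonpos: "0 < n \<Longrightarrow> sqrt_coeff n \<le> 0"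
  by (cases n) (auto simp: sqrt_coeff_def pochhammer_rec divide_nonpos_pos pochhammer_nonneg)

text \<open>The partial sums are the coefficients of \<open>sqrt (1 - x) / (1 - x)\<close>, that is,
  of \<open>1 - x\<close> to the power \<open>- 1/2\<close>, and those are positive.\<close>

lemma sum_sqrt_coeff_nonneg: "0 \<le> (\<Sum>k\<le>m. sqrt_coeff k)"
proof -
  have "(\<Sum>k\<le>m. sqrt_coeff k) = pochhammer (1/2) m / fact m"
    unfolding sqrt_coeff_gbinomial gbinomial_sum_lower_neg by (simp add: gbinomial_pochhammer)
  then show ?thesis
    by (simp add: pochhammer_nonneg)
qed

text \<open>Comparison of coefficients in \<open>(sqrt (1 - x))^2 = 1 - x\<close>: the two upper
  indices \<open>1/2\<close> add up to 1.\<close>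

lemma sum_sqrt_coeff_convolution:
  "(\<Sum>i\<le>k. sqrt_coeff i * sqrt_coeff (k - i)) = (if k = 0 then 1 else if k = 1 then -1 else 0)"
proof -
  have "(\<Sum>i\<le>k. sqrt_coeff i * sqrt_coeff (k - i))
      = (\<Sum>i=0..k. ((1/2) gchoose i) * ((1/2) gchoose (k - i))) * (- 1) ^ k"
    unfolding sum_distrib_right atLeast0AtMost
    by (intro sum.cong refl) (simp add: sqrt_coeff_gbinomial power_add[symmetric] mult_ac)
  also have "\<dots> = (1 gchoose k) * (- 1) ^ k"
    unfolding gbinomial_Vandermonde by simp
  also have "\<dots> = (if k = 0 then 1 else if k = 1 then -1 else 0)"
    using binomial_gbinomial[of 1 k, where ?'a = real] by (auto simp: binomial_eq_0)
  finally show ?thesis .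
qed

lemma summable_norm_sqrt_coeff: "summable (\<lambda>n. norm (sqrt_coeff n))"
proof (rule summableI_nonneg_bounded)
  fix n
  have "(\<Sum>k<n. norm (sqrt_coeff k)) \<le> (\<Sum>k\<le>n. \<bar>sqrt_coeff k\<bar>)"
    by (auto intro: sum_mono2)
  \<comment> \<open>The 2 serves the constant term, \<open>1 = 2 - 1\<close>; all other coefficients
    are nonpositive, so their absolute values are their negatives.\<close>
  also have "\<dots> = (\<Sum>k\<le>n. (if k = 0 then 2 else 0) - sqrt_coeff k)"
    by (intro sum.cong) (auto simp: sqrt_coeff_nonpos abs_of_nonpos)
  also have "\<dots> \<le> 2"
    using sum_sqrt_coeff_nonneg[of n] by (simp add: sum_subtractf)
  finally show "(\<Sum>k<n. norm (sqrt_coeff k)) \<le> 2" .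
qed auto

lemma abs_summable_sqrt_coeff: "(\<lambda>n. norm (sqrt_coeff n)) summable_on A"
proof (rule summable_on_subset_banach)
  show "(\<lambda>n. norm (sqrt_coeff n)) summable_on UNIV"
    using summable_norm_sqrt_coeff by (intro norm_summable_imp_summable_on) simp
qed simp

lemma summable_sqrt_coeff: "sqrt_coeff summable_on A"
  by (rule abs_summable_summable) (rule abs_summable_sqrt_coeff)

lemma infsum_sqrt_coeff_nonneg: "0 \<le> (\<Sum>\<^sub>\<infinity>n. sqrt_coeff n)"
proof -
  have "sqrt_coeff sums (\<Sum>\<^sub>\<infinity>n. sqrt_coeff n)"
    by (intro has_sum_imp_sums has_sum_infsum summable_sqrt_coeff)
  then have "(\<lambda>m. \<Sum>k\<le>m. sqrt_coeff k) \<longlonglongrightarrow> (\<Sum>\<^sub>\<infinity>n. sqrt_coeff n)"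
    by (simp add: sums_def_le)
  then show ?thesis
    by (rule LIMSEQ_le_const) (auto intro: sum_sqrt_coeff_nonneg)
qed

text \<open>The series for \<open>sqrt (1 - X)\<close>, evaluated pointwise. As an unordered sum it
  can be regrouped by total degree.\<close>

definition binomial_sqrt :: "('a::real_normed_vector \<Rightarrow> 'a) \<Rightarrow> 'a \<Rightarrow> 'a" where
  "binomial_sqrt X y = (\<Sum>\<^sub>\<infinity>n. sqrt_coeff n *\<^sub>R (X ^^ n) y)"

lemma norm_funpow_le:
  fixes X :: "'a::real_normed_vector \<Rightarrow> 'a"
  assumes "\<And>y. norm (X y) \<le> norm y"
  shows "norm ((X ^^ n) y) \<le> norm y"
proof (induction n)
  case (Suc n)
  then show ?case
    using assms[of "(X ^^ n) y"] by simp
qed simp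

lemma bounded_linear_funpow:
  fixes X :: "'a::real_normed_vector \<Rightarrow> 'a"
  assumes "bounded_linear X"
  shows "bounded_linear (X ^^ n)"
proof (induction n)
  case 0
  then show ?case
    by (simp add: id_def bounded_linear_ident)
next
  case (Suc n)
  then show ?case
    using bounded_linear_compose[OF assms Suc] by (simp add: comp_def)
qed

lemma summable_binomial_sqrt:
  fixes X :: "'a::banach \<Rightarrow> 'a"
  assumes "\<And>y. norm (X y) \<le> norm y"
  shows "(\<lambda>n. sqrt_coeff n *\<^sub>R (X ^^ n) y) summable_on A"
proof (rule abs_summable_summable, rule Infinite_Sum.abs_summable_on_comparison_test)
  show "(\<lambda>n. norm (sqrt_coeff n * norm y)) summable_on A"
    using summable_on_cmult_left[OF abs_summable_sqrt_coeff, of "norm y"] by (simp add: abs_mult)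
  show "norm (sqrt_coeff n *\<^sub>R (X ^^ n) y) \<le> norm (sqrt_coeff n * norm y)" for n
    using norm_funpow_le[OF assms] by (simp add: abs_mult mult_left_mono)
qed

lemma bounded_linear_infsum:
  assumes "bounded_linear h" and "f summable_on A"
  shows "h (infsum f A) = (\<Sum>\<^sub>\<infinity>x\<in>A. h (f x))"
  using infsum_bounded_linear_strong[OF _ assms(1)] summable_on_bounded_linear[OF assms] assms(2)
  by metis

text \<open>The Cauchy product of the coefficients collapses to \<open>1 - x\<close> by Vandermonde's identity.\<close>

lemma binomial_sqrt_square:
  fixes X :: "'a::banach \<Rightarrow> 'a"
  assumes X: "bounded_linear X" and le: "\<And>y. norm (X y) \<le> norm y"
  shows "binomial_sqrt X (binomial_sqrt X y) = y - X y"
proof -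
  let ?s = sqrt_coeff
  define g where "g m n = (?s m * ?s n) *\<^sub>R (X ^^ (m + n)) y" for m n
  \<comment> \<open>The majorant is a product of a series in \<open>m\<close> and one in
    \<open>n\<close>, so the double family may be summed in any order.\<close>
  have "(\<lambda>p. norm (case p of (m, n) \<Rightarrow> ?s m * ?s n * norm y)) summable_on UNIV \<times> UNIV"
  proof -
    have "(\<lambda>n. norm (?s m * ?s n * norm y)) = (\<lambda>n. (\<bar>?s m\<bar> * norm y) * norm (?s n))" for m
      by (auto simp: abs_mult)
    then show ?thesis
      unfolding Infinite_Sum.abs_summable_on_Sigma_iff
      using summable_on_cmult_right[OF abs_summable_sqrt_coeff] abs_summable_sqrt_coeff
      by (auto simp: infsum_cmult_right' abs_mult infsum_nonneg intro!: summable_on_cmult_left)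
  qed
  then have "(\<lambda>p. norm (case p of (m, n) \<Rightarrow> g m n)) summable_on UNIV \<times> UNIV"
    by (rule Infinite_Sum.abs_summable_on_comparison_test)
      (auto simp: g_def abs_mult mult_left_mono norm_funpow_le[OF le])
  then have sum: "(\<lambda>(m, n). g m n) summable_on UNIV \<times> UNIV"
    by (rule abs_summable_summable)
  \<comment> \<open>Pairs \<open>(m, n)\<close> are grouped by \<open>k = m + n\<close> with
    \<open>i = m\<close>; \<open>k - i\<close> is a true difference because
    \<open>i \<le> k\<close>.\<close>
  have bij: "bij_betw (\<lambda>(k, i). (i, k - i)) (SIGMA k:UNIV. {..k}) (UNIV \<times> (UNIV :: nat set))"
    by (rule bij_betw_byWitness[where f' = "\<lambda>(m, n). (m + n, m)"]) auto
  have sum': "(\<lambda>(k, i). g i (k - i)) summable_on (SIGMA k:UNIV. {..k})"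
    using sum summable_on_reindex_bij_betw[OF bij, of "\<lambda>(m, n). g m n"]
    by (simp add: case_prod_unfold)
  have "binomial_sqrt X (binomial_sqrt X y) = (\<Sum>\<^sub>\<infinity>m. \<Sum>\<^sub>\<infinity>n. g m n)"
    unfolding binomial_sqrt_def
    by (simp add: g_def bounded_linear_infsum[OF bounded_linear_funpow[OF X] summable_binomial_sqrt[OF le]]
        infsum_scaleR_right[symmetric] funpow_add
        linear_scale[OF bounded_linear.linear[OF bounded_linear_funpow[OF X]]])
  also have "\<dots> = (\<Sum>\<^sub>\<infinity>(m, n)\<in>UNIV \<times> UNIV. g m n)"
    by (rule infsum_Sigma'_banach[OF sum])
  also have "\<dots> = (\<Sum>\<^sub>\<infinity>(k, i)\<in>(SIGMA k:UNIV. {..k}). g i (k - i))"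
    using infsum_reindex_bij_betw[OF bij, of "\<lambda>(m, n). g m n"] by (simp add: case_prod_unfold)
  also have "\<dots> = (\<Sum>\<^sub>\<infinity>k. \<Sum>\<^sub>\<infinity>i\<in>{..k}. g i (k - i))"
    by (rule infsum_Sigma'_banach[OF sum', symmetric])
  also have "\<dots> = (\<Sum>\<^sub>\<infinity>k. (\<Sum>i\<le>k. ?s i * ?s (k - i)) *\<^sub>R (X ^^ k) y)"
    by (intro infsum_cong) (simp add: g_def scaleR_sum_left)
  also have "\<dots> = (\<Sum>\<^sub>\<infinity>k\<in>{0, 1}. (\<Sum>i\<le>k. ?s i * ?s (k - i)) *\<^sub>R (X ^^ k) y)"
    unfolding sum_sqrt_coeff_convolution by (rule infsum_cong_neutral) auto
  also have "\<dots> = y - X y"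
    unfolding sum_sqrt_coeff_convolution by simp
  finally show ?thesis .
qed

lemma binomial_sqrt_add:
  fixes X :: "'a::banach \<Rightarrow> 'a"
  assumes X: "bounded_linear X" and le: "\<And>y. norm (X y) \<le> norm y"
  shows "binomial_sqrt X (x + y) = binomial_sqrt X x + binomial_sqrt X y"
  unfolding binomial_sqrt_def
  by (simp add: linear_add[OF bounded_linear.linear[OF bounded_linear_funpow[OF X]]]
      scaleR_add_right infsum_add summable_binomial_sqrt[OF le])

lemma bounded_linear_scaleC: "bounded_linear (\<lambda>x::'a::complex_inner. c *\<^sub>C x)"
  by (rule bounded_linear_intro[of _ "cmod c"])
    (auto simp: scaleC_add_right scaleR_scaleC scaleC_scaleC norm_scaleC mult.commute)

lemma scaleC_scaleR: "c *\<^sub>C (r *\<^sub>R x) = r *\<^sub>R (c *\<^sub>C x)" for x :: "'a::complex_vector"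
  by (simp add: scaleR_scaleC scaleC_scaleC mult.commute)

lemma binomial_sqrt_scaleC:
  fixes X :: "'a::chilbert_space \<Rightarrow> 'a"
  assumes le: "\<And>y. norm (X y) \<le> norm y" and scale: "\<And>c y. X (c *\<^sub>C y) = c *\<^sub>C X y"
  shows "binomial_sqrt X (c *\<^sub>C y) = c *\<^sub>C binomial_sqrt X y"
proof -
  have "(X ^^ n) (c *\<^sub>C y) = c *\<^sub>C (X ^^ n) y" for n
    by (induction n) (auto simp: scale)
  then show ?thesis
    unfolding binomial_sqrt_def
    by (simp add: bounded_linear_infsum[OF bounded_linear_scaleC summable_binomial_sqrt[OF le]]
        scaleC_scaleR)
qed

lemma binomial_sqrt_symmetric:
  fixes X :: "'a::chilbert_space \<Rightarrow> 'a"
  assumes le: "\<And>y. norm (X y) \<le> norm y" and sym: "\<And>x y. cinner (X x) y = cinner x (X y)"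
  shows "cinner (binomial_sqrt X x) y = cinner x (binomial_sqrt X y)"
proof -
  have "cinner ((X ^^ n) x) y = cinner x ((X ^^ n) y)" for n x y
    by (induction n arbitrary: x y) (auto simp: sym funpow_swap1)
  then show ?thesis
    unfolding binomial_sqrt_def
    by (simp add: bounded_linear_infsum[OF bounded_linear_cinner_left summable_binomial_sqrt[OF le]]
        bounded_linear_infsum[OF bounded_linear_cinner_right summable_binomial_sqrt[OF le]]
        cinner_scaleR_left cinner_scaleR_right)
qed

text \<open>For \<open>n > 0\<close> the form of \<open>X ^^ n\<close> is at most
  \<open>(norm y)^2\<close> and its coefficient is nonpositive. Termwise the series thus dominates
  \<open>(norm y)^2\<close> times the coefficient series.\<close>

lemma binomial_sqrt_nonneg:
  fixes X :: "'a::chilbert_space \<Rightarrow> 'a"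
  assumes le: "\<And>y. norm (X y) \<le> norm y"
  shows "0 \<le> Re (cinner (binomial_sqrt X y) y)"
proof -
  have bl: "bounded_linear (\<lambda>x. Re (cinner x y))"
    by (rule bounded_linear_compose[OF bounded_linear_Re bounded_linear_cinner_left])
  have "0 \<le> (\<Sum>\<^sub>\<infinity>n. sqrt_coeff n) * (norm y)\<^sup>2"
    by (simp add: infsum_sqrt_coeff_nonneg)
  also have "\<dots> = (\<Sum>\<^sub>\<infinity>n. sqrt_coeff n * (norm y)\<^sup>2)"
    by (simp add: infsum_cmult_left')
  also have "\<dots> \<le> (\<Sum>\<^sub>\<infinity>n. Re (cinner (sqrt_coeff n *\<^sub>R (X ^^ n) y) y))"
  proof (rule infsum_mono)
    show "(\<lambda>n. sqrt_coeff n * (norm y)\<^sup>2) summable_on UNIV"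
      by (intro summable_on_cmult_left summable_sqrt_coeff)
    show "(\<lambda>n. Re (cinner (sqrt_coeff n *\<^sub>R (X ^^ n) y) y)) summable_on UNIV"
      by (rule summable_on_bounded_linear[OF bl summable_binomial_sqrt[OF le]])
    show "sqrt_coeff n * (norm y)\<^sup>2 \<le> Re (cinner (sqrt_coeff n *\<^sub>R (X ^^ n) y) y)" for n
    proof (cases "n = 0")
      case True
      then show ?thesis
        by (simp add: cinner_scaleR_left power2_norm_cinner)
    next
      case False
      have "Re (cinner ((X ^^ n) y) y) \<le> norm ((X ^^ n) y) * norm y"
        by (rule Re_cinner_le)
      also have "\<dots> \<le> (norm y)\<^sup>2"
        unfolding power2_eq_square by (intro mult_right_mono norm_funpow_le le) auto
      finally show ?thesis
        using False sqrt_coeff_nonpos[of n] by (simp add: cinner_scaleR_left mult_left_mono_neg)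
    qed
  qed
  also have "\<dots> = Re (cinner (binomial_sqrt X y) y)"
    unfolding binomial_sqrt_def
    by (rule bounded_linear_infsum[OF bl summable_binomial_sqrt[OF le], symmetric])
  finally show ?thesis .
qed

subsection \<open>Uniformly positive operators\<close>

lemma adjoint_operator_eq_SomeI:
  fixes S :: "'a::complex_inner \<rightharpoonup> 'a"
  assumes "closure (dom S) = UNIV" and z: "\<And>x. x \<in> dom S \<Longrightarrow> cinner (the (S x)) y = cinner x z"
  shows "adjoint_operator S y = Some z"
proof -
  have "(THE z. \<forall>x\<in>dom S. cinner (the (S x)) y = cinner x z) = z"
    using z by (intro the_equality) (auto intro: cinner_ext_dense[OF assms(1)])
  then show ?thesis
    using z unfolding adjoint_operator_def by auto
qed

text \<open>Maximality of selfadjoint operators: a weak equation tested on \<open>dom S\<close> puts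
  \<open>y\<close> into the domain. Limits and kernel vectors of \<open>B\<close> are identified
  this way.\<close>

lemma selfadjoint_eq_SomeI:
  fixes S :: "'a::complex_inner \<rightharpoonup> 'a"
  assumes "selfadjoint S" and "\<And>x. x \<in> dom S \<Longrightarrow> cinner (the (S x)) y = cinner x z"
  shows "S y = Some z"
  using adjoint_operator_eq_SomeI[of S y z] assms by (simp add: selfadjoint_def)

lemma selfadjoint_symmetric:
  fixes S :: "'a::complex_inner \<rightharpoonup> 'a"
  assumes S: "selfadjoint S" and x: "x \<in> dom S" and y: "y \<in> dom S"
  shows "cinner (the (S x)) y = cinner x (the (S y))"
proof -
  have "adjoint_operator S y \<noteq> None"
    using S y by (auto simp: selfadjoint_def)
  then obtain z where z: "\<And>x. x \<in> dom S \<Longrightarrow> cinner (the (S x)) y = cinner x z"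
    unfolding adjoint_operator_def by (auto split: if_splits)
  then have "S y = Some z"
    by (rule selfadjoint_eq_SomeI[OF S])
  then show ?thesis
    using z[OF x] by simp
qed

lemma bounded_below_byD:
  "bounded_below_by S c \<Longrightarrow> x \<in> dom S \<Longrightarrow> c * (norm x)\<^sup>2 \<le> Re (cinner (the (S x)) x)"
  by (simp add: bounded_below_by_def)

lemma selfadjoint_total:
  fixes R :: "'a::complex_inner \<Rightarrow> 'a"
  assumes "\<And>x y. R (x + y) = R x + R y" and "\<And>c x. R (c *\<^sub>C x) = c *\<^sub>C R x"
    and "\<And>x y. cinner (R x) y = cinner x (R y)"
  shows "selfadjoint (\<lambda>x. Some (R x))"
  unfolding selfadjoint_def linear_operator_def
  using assms by (auto intro!: ext adjoint_operator_eq_SomeI)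

lemma uniformly_positive_surj:
  fixes B :: "'a::chilbert_space \<rightharpoonup> 'a"
  assumes B: "selfadjoint B" and "0 < c" and c: "bounded_below_by B c"
  shows "ran B = UNIV"
proof (rule ccontr)
  assume "ran B \<noteq> UNIV"
  have lin: "linear_operator B"
    using B by (simp add: selfadjoint_def)
  have ran: "ran B = (\<lambda>x. the (B x)) ` dom B"
    by (force simp: ran_def)
  \<comment> \<open>Cauchy-Schwarz on the lower bound; it carries convergence of values back to
    convergence of arguments.\<close>
  have lower: "c * norm x \<le> norm (the (B x))" if "x \<in> dom B" for x
  proof (cases "x = 0")
    case False
    have "c * norm x * norm x \<le> norm (the (B x)) * norm x"
      using bounded_below_byD[OF c that] Re_cinner_le[of "the (B x)" x]
      by (simp add: power2_eq_square)
    then show ?thesis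
      using False by simp
  qed simp
  have "closed (ran B)"
    unfolding closed_sequential_limits
  proof (intro allI impI, elim conjE)
    fix u y assume "\<forall>n. u n \<in> ran B" and u: "u \<longlonglongrightarrow> y"
    then have "\<forall>n. \<exists>x. x \<in> dom B \<and> u n = the (B x)"
      unfolding ran by blast
    then obtain v where v: "\<And>n. v n \<in> dom B" "\<And>n. u n = the (B (v n))"
      by metis
    have diff: "c * norm (v m - v n) \<le> norm (u m - u n)" for m n
    proof -
      have d: "(-1) *\<^sub>C v n \<in> dom B" "the (B ((-1) *\<^sub>C v n)) = (-1) *\<^sub>C u n"
        using linear_operator_scaleC[OF lin v(1)] by (auto simp: v)
      have "v m + (-1) *\<^sub>C v n \<in> dom B" "the (B (v m + (-1) *\<^sub>C v n)) = u m + (-1) *\<^sub>C u n"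
        using linear_operator_add[OF lin v(1) d(1)] d by (auto simp: v)
      from lower[OF this(1)] this(2) show ?thesis
        by (simp add: scaleC_minus_left)
    qed
    have "Cauchy v"
    proof (rule metric_CauchyI)
      fix e :: real assume "0 < e"
      then obtain N where N: "\<And>m n. \<lbrakk>N \<le> m; N \<le> n\<rbrakk> \<Longrightarrow> dist (u m) (u n) < c * e"
        using LIMSEQ_imp_Cauchy[OF u] \<open>0 < c\<close> unfolding Cauchy_def by (meson mult_pos_pos)
      have "dist (v m) (v n) < e" if "N \<le> m" "N \<le> n" for m n
      proof -
        have "c * norm (v m - v n) < c * e"
          using N[OF that] diff[of m n] by (simp add: dist_norm)
        then show ?thesis
          using \<open>0 < c\<close> by (simp add: dist_norm)
      qed
      then show "\<exists>N. \<forall>m\<ge>N. \<forall>n\<ge>N. dist (v m) (v n) < e"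
        by blast
    qed
    then obtain x where x: "v \<longlonglongrightarrow> x"
      unfolding Cauchy_convergent_iff convergent_def by blast
    \<comment> \<open>This is closedness of \<open>B\<close>: tested against
      \<open>w \<in> dom B\<close>, the equation involves only the fixed vector \<open>B w\<close>
      and passes to the limit.\<close>
    have "B x = Some y"
    proof (rule selfadjoint_eq_SomeI[OF B])
      fix w assume w: "w \<in> dom B"
      have eq: "cinner (the (B w)) (v n) = cinner w (u n)" for n
        unfolding v(2) by (rule selfadjoint_symmetric[OF B w v(1)])
      have "(\<lambda>n. cinner w (u n)) \<longlonglongrightarrow> cinner (the (B w)) x"
        unfolding eq[symmetric] by (intro tendsto_cinner tendsto_const x)
      moreover have "(\<lambda>n. cinner w (u n)) \<longlonglongrightarrow> cinner w y"
        by (intro tendsto_cinner tendsto_const u)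
      ultimately show "cinner (the (B w)) x = cinner w y"
        by (rule LIMSEQ_unique)
    qed
    then show "y \<in> ran B"
      by (rule ranI)
  qed
  moreover have "0 \<in> ran B"
    unfolding ran using linear_operator_zero[OF lin] linear_operator_scaleC(2)[OF lin, of 0 0]
    by (intro image_eqI[of _ _ 0]) auto
  moreover have "x + y \<in> ran B" if "x \<in> ran B" "y \<in> ran B" for x y
  proof -
    obtain x' y' where "x' \<in> dom B" "y' \<in> dom B" "x = the (B x')" "y = the (B y')"
      using \<open>x \<in> ran B\<close> \<open>y \<in> ran B\<close> unfolding ran by blast
    then have "x' + y' \<in> dom B" "x + y = the (B (x' + y'))"
      by (simp_all only: linear_operator_add[OF lin])
    then show ?thesis
      unfolding ran by blast
  qed
  moreover have "a *\<^sub>C x \<in> ran B" if "x \<in> ran B" for a x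
  proof -
    obtain x' where "x' \<in> dom B" "x = the (B x')"
      using \<open>x \<in> ran B\<close> unfolding ran by blast
    then have "a *\<^sub>C x' \<in> dom B" "a *\<^sub>C x = the (B (a *\<^sub>C x'))"
      by (simp_all only: linear_operator_scaleC[OF lin])
    then show ?thesis
      unfolding ran by blast
  qed
  ultimately obtain w where w: "w \<noteq> 0" "\<And>y. y \<in> ran B \<Longrightarrow> cinner w y = 0"
    using closed_subspace_orthogonal[of "ran B"] \<open>ran B \<noteq> UNIV\<close> by metis
  have "cinner (the (B x)) w = cinner x 0" if "x \<in> dom B" for x
    using w(2)[of "the (B x)"] that cinner_commute[of "the (B x)" w] by (simp add: ran)
  then have "B w = Some 0"
    by (rule selfadjoint_eq_SomeI[OF B])
  then show False
    using lower[of w] \<open>0 < c\<close> w(1) by (auto simp: mult_le_0_iff)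
qed

text \<open>For \<open>T = B\<^sup>-\<^sup>1\<close> one has \<open>c \<parallel>Ty\<parallel>\<^sup>2 \<le> \<langle>Ty,y\<rangle>\<close>, which makes \<open>1 - cT\<close> a contraction.\<close>

lemma ex_nonneg_sqrt:
  fixes T :: "'a::chilbert_space \<Rightarrow> 'a"
  assumes "0 < c"
    and add: "\<And>x y. T (x + y) = T x + T y" and scale: "\<And>a x. T (a *\<^sub>C x) = a *\<^sub>C T x"
    and sym: "\<And>x y. cinner (T x) y = cinner x (T y)"
    and c: "\<And>y. c * (norm (T y))\<^sup>2 \<le> Re (cinner (T y) y)"
  shows "\<exists>R. selfadjoint R \<and> bounded_below_by R 0 \<and> R \<circ>\<^sub>m R = (\<lambda>x. Some (T x))"
proof -
  \<comment> \<open>Then \<open>1 - X\<close> is \<open>c\<close> times \<open>T\<close>, so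
    \<open>binomial_sqrt X\<close> squares to that multiple and has to be divided by
    \<open>sqrt c\<close>.\<close>
  define X where "X y = y - c *\<^sub>R T y" for y
  have le: "norm (X y) \<le> norm y" for y
  proof -
    have "(norm (X y))\<^sup>2 = (norm y)\<^sup>2 - 2 * c * Re (cinner (T y) y) + c * (c * (norm (T y))\<^sup>2)"
      unfolding X_def power2_norm_diff
      by (simp add: cinner_scaleR_right Re_cinner_commute[of y] power_mult_distrib power2_eq_square)
    also have "\<dots> \<le> (norm y)\<^sup>2 - 2 * c * Re (cinner (T y) y) + c * Re (cinner (T y) y)"
      using c[of y] \<open>0 < c\<close> by simp
    also have "\<dots> \<le> (norm y)\<^sup>2"
    proof -
      have "0 \<le> c * (norm (T y))\<^sup>2"
        using \<open>0 < c\<close> by simp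
      then have "0 \<le> c * Re (cinner (T y) y)"
        using c[of y] \<open>0 < c\<close> by (intro mult_nonneg_nonneg) linarith+
      then show ?thesis
        by simp
    qed
    finally show ?thesis
      by (simp add: power2_le_iff_abs_le)
  qed
  have Xadd: "X (x + y) = X x + X y" for x y
    by (simp add: X_def add scaleR_add_right)
  have Xscale: "X (a *\<^sub>C y) = a *\<^sub>C X y" for a y
    by (simp add: X_def scale scaleC_diff_right scaleC_scaleR)
  have X: "bounded_linear X"
    by (rule bounded_linear_intro[of _ 1]) (auto simp: Xadd Xscale scaleR_scaleC le)
  have Xsym: "cinner (X x) y = cinner x (X y)" for x y
    by (simp add: X_def cinner_diff_left cinner_diff_right cinner_scaleR_left cinner_scaleR_right sym)
  define R where "R y = (1 / sqrt c) *\<^sub>R binomial_sqrt X y" for y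
  have scaleR: "binomial_sqrt X (r *\<^sub>R y) = r *\<^sub>R binomial_sqrt X y" for r y
    unfolding scaleR_scaleC by (rule binomial_sqrt_scaleC[OF le Xscale])
  have "R (R y) = T y" for y
    using \<open>0 < c\<close> by (simp add: R_def scaleR binomial_sqrt_square[OF X le]) (simp add: X_def)
  then have "(\<lambda>x. Some (R x)) \<circ>\<^sub>m (\<lambda>x. Some (R x)) = (\<lambda>x. Some (T x))"
    by (simp add: map_comp_def)
  moreover have "bounded_below_by (\<lambda>x. Some (R x)) 0"
    using binomial_sqrt_nonneg[OF le] \<open>0 < c\<close>
    by (simp add: bounded_below_by_def R_def cinner_scaleR_left)
  moreover have "selfadjoint (\<lambda>x. Some (R x))"
    by (rule selfadjoint_total)
      (simp_all add: R_def binomial_sqrt_add[OF X le] scaleR_add_right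
        binomial_sqrt_scaleC[OF le Xscale] scaleC_scaleR cinner_scaleR_left cinner_scaleR_right
        binomial_sqrt_symmetric[OF le Xsym])
  ultimately show ?thesis
    by blast
qed

text \<open>The last property says that \<open>B\<close> is the inverse of \<open>R\<close> applied
  twice, domain included.\<close>

lemma inverse_sqrt_operator_uniformly_positive:
  fixes B :: "'a::chilbert_space \<rightharpoonup> 'a"
  assumes "uniformly_positive B"
  obtains R where "inverse_sqrt_operator B = (\<lambda>x. Some (R x))"
    "\<And>x y. R (x + y) = R x + R y" "\<And>c x. R (c *\<^sub>C x) = c *\<^sub>C R x"
    "\<And>x y. cinner (R x) y = cinner x (R y)"
    "\<And>x y. B x = Some y \<longleftrightarrow> x = R (R y)"
proof -
  obtain c where B: "selfadjoint B" and "0 < c" and c: "bounded_below_by B c"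
    using assms by (auto simp: uniformly_positive_def)
  have lin: "linear_operator B"
    using B by (simp add: selfadjoint_def)
  have B0: "B 0 = Some 0"
    using linear_operator_zero[OF lin] linear_operator_scaleC(2)[OF lin, of 0 0] by auto
  have inj: "x = x'" if "B x = Some y" "B x' = Some y" for x x' y
  proof -
    have "x' \<in> dom B" "x \<in> dom B"
      using that by auto
    note d = linear_operator_scaleC[OF lin this(1), of "-1"]
    have "x + (-1) *\<^sub>C x' \<in> dom B" "the (B (x + (-1) *\<^sub>C x')) = 0"
      using linear_operator_add[OF lin \<open>x \<in> dom B\<close> d(1)] d that by (auto simp: scaleC_minus_left)
    then have "c * (norm (x - x'))\<^sup>2 \<le> 0"
      using bounded_below_byD[OF c, of "x - x'"] by (simp add: scaleC_minus_left)
    then show ?thesis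
      using \<open>0 < c\<close> by (simp add: mult_le_0_iff)
  qed
  define T where "T y = (THE x. B x = Some y)" for y
  have ran: "ran B = UNIV"
    by (rule uniformly_positive_surj[OF B \<open>0 < c\<close> c])
  have T: "B x = Some y \<longleftrightarrow> x = T y" for x y
  proof -
    obtain x' where x': "B x' = Some y"
      using ran by (auto simp: ran_def)
    then have "T y = x'"
      unfolding T_def using inj by blast
    then show ?thesis
      using x' inj by blast
  qed
  have Tdom: "T y \<in> dom B" "the (B (T y)) = y" for y
    using T[of "T y" y] by auto
  have inv: "inverse_operator B = (\<lambda>y. Some (T y))"
    by (simp add: inverse_operator_def ran T_def)
  have "T (x + y) = T x + T y" for x y
    using linear_operator_add[OF lin Tdom(1) Tdom(1), of x y] Tdom(2)
    by (metis T domD option.sel)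
  moreover have "T (a *\<^sub>C x) = a *\<^sub>C T x" for a x
    using linear_operator_scaleC[OF lin Tdom(1), of a x] Tdom(2)
    by (metis T domD option.sel)
  moreover have "cinner (T x) y = cinner x (T y)" for x y
    using selfadjoint_symmetric[OF B Tdom(1) Tdom(1), of x y] by (simp add: Tdom(2))
  moreover have "c * (norm (T y))\<^sup>2 \<le> Re (cinner (T y) y)" for y
    using bounded_below_byD[OF c Tdom(1)[of y]] Re_cinner_commute[of y "T y"] by (simp add: Tdom(2))
  ultimately have ex: "\<exists>R. selfadjoint R \<and> bounded_below_by R 0 \<and> R \<circ>\<^sub>m R = inverse_operator B"
    unfolding inv by (intro ex_nonneg_sqrt[OF \<open>0 < c\<close>])
  define Q where "Q = inverse_sqrt_operator B"
  have Q: "selfadjoint Q" "Q \<circ>\<^sub>m Q = (\<lambda>y. Some (T y))"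
    using someI_ex[OF ex] unfolding Q_def inverse_sqrt_operator_def sqrt_operator_def inv by auto
  define R where "R x = the (Q x)" for x
  \<comment> \<open>The root is everywhere defined because its square is:
    \<open>Q \<circ>\<^sub>m Q\<close> is undefined wherever \<open>Q\<close> is.\<close>
  have "Q x \<noteq> None" for x
    using fun_cong[OF Q(2), of x] by (cases "Q x") (auto simp: map_comp_def)
  then have QR: "Q = (\<lambda>x. Some (R x))"
    by (auto simp: R_def)
  show thesis
  proof (rule that[of R])
    show "inverse_sqrt_operator B = (\<lambda>x. Some (R x))"
      using QR by (simp add: Q_def)
    show "R (x + y) = R x + R y" "R (a *\<^sub>C x) = a *\<^sub>C R x" for x y a
      using Q(1) unfolding QR selfadjoint_def linear_operator_def by simp_all
    show "cinner (R x) y = cinner x (R y)" for x y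
      using selfadjoint_symmetric[OF Q(1), of x y] unfolding QR by simp
    show "B x = Some y \<longleftrightarrow> x = R (R y)" for x y
      using fun_cong[OF Q(2), of y] unfolding T QR by (simp add: map_comp_def)
  qed
qed

section \<open>From the pencil to a single operator\<close>

lemma uniformly_positive_quotient_range:
  fixes A B :: "'a::chilbert_space \<rightharpoonup> 'a"
  assumes A: "linear_operator A" and sub: "dom A \<subseteq> dom B" and B: "uniformly_positive B"
  defines "C \<equiv> inverse_sqrt_operator B \<circ>\<^sub>m A \<circ>\<^sub>m inverse_sqrt_operator B"
  shows "linear_operator C" and "quotient_range A B = numerical_range C"
proof -
  obtain R where Q: "inverse_sqrt_operator B = (\<lambda>x. Some (R x))"
    and add: "\<And>x y. R (x + y) = R x + R y" and scale: "\<And>c x. R (c *\<^sub>C x) = c *\<^sub>C R x"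
    and sym: "\<And>x y. cinner (R x) y = cinner x (R y)"
    and BR: "\<And>x y. B x = Some y \<longleftrightarrow> x = R (R y)"
    by (rule inverse_sqrt_operator_uniformly_positive[OF B]) (rule that)
  \<comment> \<open>\<open>R\<close> is total, so the outer factor of the product puts no condition
    on the domain.\<close>
  have domC: "y \<in> dom C \<longleftrightarrow> R y \<in> dom A" for y
    by (auto simp: C_def Q map_comp_def dom_def split: option.splits)
  have C: "the (C y) = R (the (A (R y)))" if "y \<in> dom C" for y
    using that unfolding domC by (auto simp: C_def Q map_comp_def)
  have CA: "cinner (the (C y)) y = cinner (the (A (R y))) (R y)" if "y \<in> dom C" for y
    using that by (simp add: C sym)
  have R0: "R 0 = 0"
    using scale[of 0 0] by simp
  show linC: "linear_operator C"
    unfolding linear_operator_def domC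
    using linear_operator_zero[OF A] linear_operator_add[OF A] linear_operator_scaleC[OF A]
    by (auto simp: R0 add scale C domC simp del: domIff)
  have B_form: "cinner (the (B (R y))) (R y) = complex_of_real ((norm y)\<^sup>2)"
    if y: "R y \<in> dom B" for y
  proof -
    obtain w where w: "B (R y) = Some w"
      using y by auto
    \<comment> \<open>Injectivity of \<open>R\<close> is needed here: if \<open>R u = 0\<close>,
      then \<open>R (R u) = 0\<close> makes \<open>u\<close> the value of \<open>B\<close> at 0,
      hence \<open>u = 0\<close>.\<close>
    define u where "u = R w + (-1) *\<^sub>C y"
    have "R u = 0"
      using w unfolding BR u_def add scale by (simp add: scaleC_minus_left)
    then have "B 0 = Some u"
      unfolding BR by (simp add: R0)
    moreover have "B 0 = Some 0"
      unfolding BR by (simp add: R0)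
    ultimately have "R w = y"
      by (simp add: u_def scaleC_minus_left)
    then have "cinner w (R y) = cinner y y"
      using sym[of w y] by simp
    then show ?thesis
      by (simp add: w cinner_self)
  qed
  show "quotient_range A B = numerical_range C"
  proof (intro set_eqI iffI)
    fix \<mu> assume "\<mu> \<in> quotient_range A B"
    then obtain x where x: "x \<in> dom A" "cinner (the (B x)) x \<noteq> 0"
      "\<mu> = cinner (the (A x)) x / cinner (the (B x)) x"
      unfolding quotient_range_def by blast
    \<comment> \<open>A preimage of \<open>x\<close> under \<open>R\<close>, since
      \<open>x = R (R (the (B x)))\<close>; this is where \<open>dom A \<subseteq> dom B\<close>
      enters.\<close>
    define y where "y = R (the (B x))"
    have "x \<in> dom B"
      using x(1) sub by auto
    then have Ry: "R y = x"
      using BR[of x "the (B x)"] by (simp add: y_def domIff)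
    then have y: "y \<in> dom C"
      using x(1) by (simp add: domC)
    have "cinner (the (B x)) x = complex_of_real ((norm y)\<^sup>2)"
      using B_form[of y] \<open>x \<in> dom B\<close> by (simp add: Ry)
    then have "y \<noteq> 0" and \<mu>: "\<mu> = cinner (the (C y)) y / complex_of_real ((norm y)\<^sup>2)"
      using x by (auto simp: CA[OF y] Ry)
    then show "\<mu> \<in> numerical_range C"
      unfolding numerical_range_def mem_Collect_eq \<mu> quadratic_form_normalized[OF linC y, symmetric]
      using norm_normalized linear_operator_scaleC(1)[OF linC y] by blast
  next
    fix \<mu> assume "\<mu> \<in> numerical_range C"
    then obtain y where y: "y \<in> dom C" "norm y = 1" "\<mu> = cinner (the (C y)) y"
      unfolding numerical_range_def by blast
    then have "R y \<in> dom A"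
      by (simp add: domC)
    moreover from this have "cinner (the (B (R y))) (R y) = 1"
      using B_form[of y] sub y(2) by auto
    ultimately show "\<mu> \<in> quotient_range A B"
      unfolding quotient_range_def mem_Collect_eq using y by (intro exI[of _ "R y"]) (simp add: CA)
  qed
qed

lemma uniformly_positive_zero_notin_closure:
  assumes "uniformly_positive B"
  shows "0 \<notin> closure (numerical_range B)"
proof -
  obtain c where "0 < c" and c: "bounded_below_by B c"
    using assms by (auto simp: uniformly_positive_def)
  have "c \<le> cmod (cinner (the (B x)) x)" if "x \<in> dom B" "norm x = 1" for x
  proof -
    have "c \<le> Re (cinner (the (B x)) x)"
      using bounded_below_byD[OF c that(1)] that(2) by simp
    then show ?thesis
      using complex_Re_le_cmod order_trans by blast
  qed
  then show ?thesis
    unfolding zero_in_closure_numerical_range_iff using \<open>0 < c\<close> by (meson not_le)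
qed

lemma uniformly_positive_convex_pencil_range:
  fixes A B :: "'a::chilbert_space \<rightharpoonup> 'a"
  assumes "linear_operator A" and "dom A \<subseteq> dom B" and B: "uniformly_positive B"
  shows "convex (pencil_range A B)"
proof -
  obtain c where "selfadjoint B" "0 < c" and c: "bounded_below_by B c"
    using B by (auto simp: uniformly_positive_def)
  have "cinner (the (B x)) x \<in> \<real>" if "x \<in> dom B" for x
    using selfadjoint_symmetric[OF \<open>selfadjoint B\<close> that that]
    by (metis Reals_cnj_iff cinner_commute)
  moreover have "0 \<le> Re (cinner (the (B x)) x)" if "x \<in> dom B" for x
  proof -
    have "0 \<le> c * (norm x)\<^sup>2"
      using \<open>0 < c\<close> by simp
    then show ?thesis
      using bounded_below_byD[OF c that] by simp
  qed
  ultimately show ?thesis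
    using assms \<open>selfadjoint B\<close> by (intro convex_pencil_range) (auto simp: selfadjoint_def subset_iff)
qed

theorem proposition2p3:
  fixes A B :: "'a::chilbert_space \<rightharpoonup> 'a"
  assumes "linear_operator A" and "linear_operator B" and "dom A \<subseteq> dom B"
  shows "quotient_range A B \<subseteq> pencil_range A B \<and>
    (0 \<notin> closure (numerical_range A) \<inter> closure (numerical_range B) \<or> pencil_range A B \<noteq> UNIV \<longrightarrow>
       pencil_range A B \<subseteq> closure (quotient_range A B)) \<and>
    (uniformly_positive B \<longrightarrow>
       (let C = inverse_sqrt_operator B \<circ>\<^sub>m A \<circ>\<^sub>m inverse_sqrt_operator B in
         quotient_range A B = numerical_range C \<and>
         closure (pencil_range A B) = closure (quotient_range A B) \<and>
         closure (quotient_range A B) = closure (numerical_range C) \<and>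
         convex (quotient_range A B) \<and>
         convex (numerical_range C) \<and>
         convex (pencil_range A B) \<and>
         convex (closure (pencil_range A B)) \<and>
         convex (closure (quotient_range A B)) \<and>
         convex (closure (numerical_range C))))"
proof (intro conjI impI)
  show sub: "quotient_range A B \<subseteq> pencil_range A B"
    by (rule quotient_range_subset_pencil_range[OF assms])
  show closure: "pencil_range A B \<subseteq> closure (quotient_range A B)"
    if "0 \<notin> closure (numerical_range A) \<inter> closure (numerical_range B) \<or> pencil_range A B \<noteq> UNIV"
    using that pencil_range_subset_closure_if_zero_notin[OF assms(3)]
      pencil_range_subset_closure_if_not_UNIV by blast
  assume B: "uniformly_positive B"
  define C where "C = inverse_sqrt_operator B \<circ>\<^sub>m A \<circ>\<^sub>m inverse_sqrt_operator B"
  have eq: "quotient_range A B = numerical_range C"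
    unfolding C_def by (rule uniformly_positive_quotient_range[OF assms(1,3) B])
  have "convex (numerical_range C)"
    unfolding C_def
    by (intro convex_numerical_range uniformly_positive_quotient_range[OF assms(1,3) B])
  moreover have "convex (pencil_range A B)"
    by (rule uniformly_positive_convex_pencil_range[OF assms(1,3) B])
  moreover have "closure (pencil_range A B) = closure (quotient_range A B)"
  proof
    \<comment> \<open>The first alternative of (i) applies, because the lower bound keeps 0 away
      from the numerical range of \<open>B\<close>.\<close>
    have "pencil_range A B \<subseteq> closure (quotient_range A B)"
      using closure uniformly_positive_zero_notin_closure[OF B] by blast
    then show "closure (pencil_range A B) \<subseteq> closure (quotient_range A B)"
      by (simp add: closure_minimal)
  qed (rule closure_mono[OF sub])
  ultimately show "let C = inverse_sqrt_operator B \<circ>\<^sub>m A \<circ>\<^sub>m inverse_sqrt_operator B in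
         quotient_range A B = numerical_range C \<and>
         closure (pencil_range A B) = closure (quotient_range A B) \<and>
         closure (quotient_range A B) = closure (numerical_range C) \<and>
         convex (quotient_range A B) \<and>
         convex (numerical_range C) \<and>
         convex (pencil_range A B) \<and>
         convex (closure (pencil_range A B)) \<and>
         convex (closure (quotient_range A B)) \<and>
         convex (closure (numerical_range C))"
    unfolding Let_def C_def[symmetric] by (simp add: eq convex_closure)
qed

end
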